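(* Let $s_1,s_2,\dots,s_r,t$ be integers with $s_i\ge 1$ for $1\le i\le r$ and $t>2^{2\sum_{i}s_i}-2\sum_{i}s_i-1$. Then there exists a $K_{s_1,\dots,s_r,t}$-intersecting family of graphs $\mathcal{H}$ with $$|\mathcal{H}|>2^{\binom{n}{2}-\sum_{1\le i<j\le r}s_is_j-\sum_{i=1}^r s_i t}.$$
   Context: Here $n$ is the number of vertices of the graphs in a family: a family of graphs is a set $\mathcal{G}\subseteq 2^{\binom{[n]}{2}}$ of labelled graphs on the vertex set $[n]=\{1,\dots,n\}$ (each graph identified with its edge set). For two such graphs, $G_1\cap G_2$ is the graph on $[n]$ with edge set $E(G_1)\cap E(G_2)$. Given a fixed unlabelled graph $H$, the family $\mathcal{G}$ is $H$-intersecting if for every pair $G_1,G_2\in\mathcal{G}$ the graph $G_1\cap G_2$ contains a copy of $H$ (as a not necessarily induced subgraph). $K_{s_1,\dots,s_r,t}$ is the complete $(r+1)$-partite graph with parts of sizes $s_1,\dots,s_r,t$.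
   Formalization: The inequality is stated for all sufficiently large n (depending on s_1,…,s_r,t), with r ≥ 1; for every n it fails, e.g. for K_{1,2} and n = 3, where the largest intersecting family has exactly 2 = 2^{3-2} members. *)

theory Defs
  imports Complex_Main
begin

text \<open>A simple graph is a pair of a vertex set and a set of two-element edges.\<close>

type_synonym 'a graph = "'a set \<times> 'a set set"

text \<open>The parts are indexed by \<open>I\<close>, and part \<open>i\<close> consists of the vertices
  \<open>(i, a)\<close> with \<open>a < p i\<close>.\<close>

definition complete_multipartite :: "'i set \<Rightarrow> ('i \<Rightarrow> nat) \<Rightarrow> ('i \<times> nat) graph" where
  "complete_multipartite I p =
     (let V = (SIGMA i:I. {..<p i}) in (V, {{u, v} | u v. u \<in> V \<and> v \<in> V \<and> fst u \<noteq> fst v}))"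

definition contains_copy :: "'a graph \<Rightarrow> 'b graph \<Rightarrow> bool" where
  "contains_copy G H \<longleftrightarrow>
     (\<exists>f. inj_on f (fst H) \<and> f ` fst H \<subseteq> fst G \<and> (\<forall>e\<in>snd H. f ` e \<in> snd G))"

definition all_pairs :: "nat \<Rightarrow> nat set set" where
  "all_pairs n = {e. e \<subseteq> {1..n} \<and> card e = 2}"

text \<open>Members of the family \<open>F\<close> are labelled graphs on \<open>{1..n}\<close>, each identified with
  its edge set. The two members are not required to be distinct.\<close>

definition intersecting_family :: "nat \<Rightarrow> 'b graph \<Rightarrow> nat set set set \<Rightarrow> bool" where
  "intersecting_family n H F \<longleftrightarrow>
     F \<subseteq> Pow (all_pairs n) \<and>
     (\<forall>E\<^sub>1\<in>F. \<forall>E\<^sub>2\<in>F. contains_copy ({1..n}, E\<^sub>1 \<inter> E\<^sub>2) H)"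

end

theory Submission
  imports Defs
begin

text \<open>
  Write \<open>S = s\<^sub>1 + \<dots> + s\<^sub>r\<close>. Fixing all edges of one copy of \<open>K\<^bsub>s\<^sub>1,\<dots>,s\<^sub>r,t\<^esub>\<close> gives an
  intersecting family whose size is exactly the bound to be beaten. The family below gains over it
  by allowing one error: the edges of a copy of \<open>K\<^bsub>s\<^sub>1,\<dots>,s\<^sub>r\<^esub>\<close> on a set \<open>A\<close> of \<open>S\<close> vertices are
  still prescribed, but instead of \<open>t\<close> vertices joined completely to \<open>A\<close> there is a set \<open>B\<close> of
  \<open>t + 2\<close> vertices, and at most one of the \<open>S (t + 2)\<close> edges between \<open>A\<close> and \<open>B\<close> may be absent.

  The intersection of two such graphs lacks at most two edges between \<open>A\<close> and \<open>B\<close>. These meet at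
  most two vertices of \<open>B\<close>, so at least \<open>t\<close> vertices of \<open>B\<close> remain joined to all of \<open>A\<close>
  (\<open>contains_copy_near_complete\<close>).

  Compared with one fixed copy, \<open>2 S\<close> further edges are no longer free, a loss of a factor
  \<open>2 ^ (2 S)\<close>, but the family admits \<open>S (t + 2) + 1\<close> patterns between \<open>A\<close> and \<open>B\<close> instead of one
  (\<open>card_near_complete\<close>). The hypothesis on \<open>t\<close> says \<open>t + 2 S + 1 > 2 ^ (2 S)\<close>, and
  \<open>S (t + 2) + 1 \<ge> t + 2 S + 1\<close> because \<open>S \<ge> 1\<close>, so the gain exceeds the loss.
\<close>

section \<open>Families with at most one absent edge\<close>

definition biclique :: "'a set \<Rightarrow> 'a set \<Rightarrow> 'a set set" where
  "biclique A B = (\<lambda>(a, b). {a, b}) ` (A \<times> B)"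

definition near_complete :: "'a set \<Rightarrow> 'a set \<Rightarrow> 'a set \<Rightarrow> 'a set set" where
  "near_complete U C X = {E. C \<subseteq> E \<and> E \<subseteq> U \<and> card (X - E) \<le> 1}"

lemma card_biclique:
  assumes "A \<inter> B = {}"
  shows "card (biclique A B) = card A * card B"
proof -
  have "inj_on (\<lambda>(a, b). {a, b}) (A \<times> B)"
    using assms by (auto simp: inj_on_def doubleton_eq_iff)
  then show ?thesis
    unfolding biclique_def by (simp add: card_image card_cartesian_product)
qed

lemma card_all_pairs: "card (all_pairs n) = n choose 2"
  unfolding all_pairs_def using n_subsets[of "{1..n}" 2] by simp

text \<open>A member is determined by two independent choices: its trace on \<open>U - C - X\<close>, which is
  arbitrary, and its trace on \<open>X\<close>, which is \<open>X\<close> or \<open>X\<close> with one element removed.\<close>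

lemma card_near_complete:
  assumes U: "finite U" and CU: "C \<subseteq> U" and XU: "X \<subseteq> U" and CX: "C \<inter> X = {}"
  shows "card (near_complete U C X) = (card X + 1) * 2 ^ (card U - card C - card X)"
proof -
  define R where "R = U - C - X"
  define Zs where "Zs = insert X ((\<lambda>x. X - {x}) ` X)"
  have fin: "finite X" "finite C" "finite R"
    using U CU XU finite_subset R_def by auto
  have Zs_sub: "Z \<subseteq> X \<and> card (X - Z) \<le> 1" if "Z \<in> Zs" for Z
    using that by (auto simp: Zs_def double_diff)
  have mem_Zs: "X \<inter> E \<in> Zs" if le: "card (X - E) \<le> 1" for E
  proof (cases "X - E = {}")
    case True
    then have "X \<inter> E = X" by blast
    then show ?thesis by (simp add: Zs_def)
  next
    case False
    then have "card (X - E) = 1"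
      using le fin by (simp add: le_Suc_eq)
    then obtain x where "X - E = {x}" by (auto simp: card_1_singleton_iff)
    then have "X \<inter> E = X - {x}" "x \<in> X" by blast+
    then show ?thesis by (simp add: Zs_def)
  qed
  have inj: "inj_on (\<lambda>(Y, Z). C \<union> Y \<union> Z) (Pow R \<times> Zs)"
  proof (rule inj_onI, clarify)
    fix Y Z Y' Z'
    assume *: "Y \<subseteq> R" "Z \<in> Zs" "Y' \<subseteq> R" "Z' \<in> Zs" "C \<union> Y \<union> Z = C \<union> Y' \<union> Z'"
    have "Z \<subseteq> X" "Z' \<subseteq> X" using Zs_sub * by auto
    then have "Y = (C \<union> Y \<union> Z) \<inter> R" "Y' = (C \<union> Y' \<union> Z') \<inter> R"
      "Z = (C \<union> Y \<union> Z) \<inter> X" "Z' = (C \<union> Y' \<union> Z') \<inter> X"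
      using * CX by (auto simp: R_def)
    then show "Y = Y' \<and> Z = Z'" using *(5) by metis
  qed
  have "near_complete U C X = (\<lambda>(Y, Z). C \<union> Y \<union> Z) ` (Pow R \<times> Zs)" (is "_ = ?I")
  proof
    show "near_complete U C X \<subseteq> ?I"
    proof
      fix E assume "E \<in> near_complete U C X"
      then have E: "C \<subseteq> E" "E \<subseteq> U" "card (X - E) \<le> 1"
        by (auto simp: near_complete_def)
      then have "E = C \<union> (E \<inter> R) \<union> (X \<inter> E)" by (auto simp: R_def)
      moreover have "(E \<inter> R, X \<inter> E) \<in> Pow R \<times> Zs" using mem_Zs E by auto
      ultimately show "E \<in> ?I" by (metis (no_types, lifting) case_prod_conv image_eqI)
    qed
  next
    show "?I \<subseteq> near_complete U C X"
    proof clarify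
      fix Y Z assume *: "Y \<subseteq> R" "Z \<in> Zs"
      have "card (X - (C \<union> Y \<union> Z)) \<le> card (X - Z)"
        using fin by (intro card_mono) auto
      then show "C \<union> Y \<union> Z \<in> near_complete U C X"
        using Zs_sub[OF *(2)] * CU XU by (auto simp: near_complete_def R_def)
    qed
  qed
  then have "card (near_complete U C X) = 2 ^ card R * card Zs"
    using inj fin by (simp add: card_image card_cartesian_product card_Pow)
  moreover have "card Zs = card X + 1"
  proof -
    have "inj_on (\<lambda>x. X - {x}) X" by (auto simp: inj_on_def)
    moreover have "X \<notin> (\<lambda>x. X - {x}) ` X" by auto
    ultimately show ?thesis using fin by (simp add: Zs_def card_image)
  qed
  moreover have "card R = card U - card C - card X"
  proof -
    have "X \<subseteq> U - C" using XU CX by auto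
    then show ?thesis
      using fin CU unfolding R_def by (simp add: card_Diff_subset)
  qed
  ultimately show ?thesis by simp
qed

section \<open>Intersections inside a biclique\<close>

text \<open>Since \<open>A\<close> and \<open>B\<close> are disjoint, an edge meets \<open>B\<close> in one vertex only, so distinct spoiled
  vertices of \<open>B\<close> would need distinct absent edges.\<close>

lemma card_not_fully_joined_le_1:
  assumes "A \<inter> B = {}" "finite (biclique A B)" "card (biclique A B - E) \<le> 1" "finite B"
  shows "card {b \<in> B. \<exists>a\<in>A. {a, b} \<notin> E} \<le> 1"
proof -
  have uniq: "e = e'" if "e \<in> biclique A B - E" "e' \<in> biclique A B - E" for e e'
    using assms(2,3) that card_le_Suc0_iff_eq[of "biclique A B - E"] by auto
  have "b = b'"
    if "b \<in> B" "a \<in> A" "{a, b} \<notin> E" "b' \<in> B" "a' \<in> A" "{a', b'} \<notin> E" for a b a' b'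
  proof -
    have "{a, b} = {a', b'}"
      using that by (intro uniq) (auto simp: biclique_def)
    then show ?thesis
      using that assms(1) by (auto simp: doubleton_eq_iff)
  qed
  then show ?thesis
    using assms(4) by (auto simp: card_le_Suc0_iff_eq)
qed

text \<open>The at most two absent edges can spoil at most two vertices of \<open>B\<close>, which is why two vertices more
  than \<open>t\<close> suffice.\<close>

lemma fully_joined_subset:
  assumes AB: "A \<inter> B = {}" and fin: "finite A" "finite B" and card_B: "card B = t + 2"
    and "card (biclique A B - E1) \<le> 1" "card (biclique A B - E2) \<le> 1"
  obtains T where "T \<subseteq> B" "card T = t" "\<And>a b. a \<in> A \<Longrightarrow> b \<in> T \<Longrightarrow> {a, b} \<in> E1 \<inter> E2"
proof -
  define bad where "bad E = {b \<in> B. \<exists>a\<in>A. {a, b} \<notin> E}" for E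
  have "finite (biclique A B)" using fin by (simp add: biclique_def)
  then have "card (bad E1) \<le> 1" "card (bad E2) \<le> 1"
    using card_not_fully_joined_le_1 assms unfolding bad_def by blast+
  then have "card (bad E1 \<union> bad E2) \<le> 2"
    using card_Un_le[of "bad E1" "bad E2"] by linarith
  moreover have "card B - card (bad E1 \<union> bad E2) \<le> card (B - (bad E1 \<union> bad E2))"
    using fin by (intro diff_card_le_card_Diff) (auto simp: bad_def)
  ultimately have "t \<le> card (B - (bad E1 \<union> bad E2))"
    using card_B by linarith
  then obtain T where "T \<subseteq> B - (bad E1 \<union> bad E2)" "card T = t"
    by (rule obtain_subset_with_card_n)
  then show thesis
    by (intro that[of T]) (auto simp: bad_def)
qed

section \<open>Complete multipartite graphs\<close>

lemma complete_multipartite_edge_iff: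
  "e \<in> snd (complete_multipartite I p) \<longleftrightarrow>
     (\<exists>u v. e = {u, v} \<and> u \<in> fst (complete_multipartite I p) \<and>
        v \<in> fst (complete_multipartite I p) \<and> fst u \<noteq> fst v)"
  by (simp add: complete_multipartite_def Let_def)

lemma fst_complete_multipartite:
  "fst (complete_multipartite I p) = (SIGMA i:I. {..<p i})"
  by (simp add: complete_multipartite_def Let_def)

text \<open>Every edge is listed once with the smaller part index first, which makes the bound match
  the exponent of the theorem.\<close>

lemma card_complete_multipartite_edges_le:
  fixes s :: "nat \<Rightarrow> nat"
  shows "card (snd (complete_multipartite {1..r} s)) \<le> (\<Sum>j=1..r. \<Sum>i=1..<j. s i * s j)"
proof -
  define P where "P = (SIGMA j:{1..r}. SIGMA i:{1..<j}. {..<s i} \<times> {..<s j})"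
  define edge where "edge = (\<lambda>(j, i, a, b). {(i :: nat, a :: nat), (j, b :: nat)})"
  have sub: "snd (complete_multipartite {1..r} s) \<subseteq> edge ` P"
  proof
    fix e assume "e \<in> snd (complete_multipartite {1..r} s)"
    then obtain i a j b where e: "e = {(i, a), (j, b)}" and "i \<noteq> j"
      and mem: "i \<in> {1..r}" "j \<in> {1..r}" "a < s i" "b < s j"
      by (auto simp: complete_multipartite_edge_iff fst_complete_multipartite)
    then consider "i < j" | "j < i" by linarith
    then show "e \<in> edge ` P"
    proof cases
      case 1
      then have "(j, i, a, b) \<in> P" using mem by (auto simp: P_def)
      moreover have "e = edge (j, i, a, b)" by (simp add: e edge_def)
      ultimately show ?thesis by blast
    next
      case 2
      then have "(i, j, b, a) \<in> P" using mem by (auto simp: P_def)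
      moreover have "e = edge (i, j, b, a)" by (simp add: e edge_def insert_commute)
      ultimately show ?thesis by blast
    qed
  qed
  have "finite P" by (auto simp: P_def)
  then have "card (snd (complete_multipartite {1..r} s)) \<le> card P"
    using sub by (meson card_image_le card_mono finite_imageI le_trans)
  also have "card P = (\<Sum>j=1..r. \<Sum>i=1..<j. s i * s j)"
    by (simp add: P_def card_cartesian_product)
  finally show ?thesis .
qed

text \<open>The part of size \<open>t\<close> goes to \<open>t\<close> vertices of \<open>B\<close> that both graphs join to all of \<open>A\<close>; the
  other parts go to their prescribed places in \<open>A\<close>.\<close>

lemma contains_copy_near_complete:
  fixes s :: "nat \<Rightarrow> nat"
  assumes g: "bij_betw g (fst (complete_multipartite {1..r} s)) A"
    and C: "C = (\<lambda>e. g ` e) ` snd (complete_multipartite {1..r} s)"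
    and AB: "A \<inter> B = {}" and fin: "finite A" "finite B" and card_B: "card B = t + 2"
    and V: "A \<union> B \<subseteq> V"
    and E1: "E1 \<in> near_complete U C (biclique A B)"
    and E2: "E2 \<in> near_complete U C (biclique A B)"
  shows "contains_copy (V, E1 \<inter> E2) (complete_multipartite {1..r+1} (s(r+1 := t)))"
proof -
  let ?K = "complete_multipartite {1..r} s"
  let ?H = "complete_multipartite {1..r+1} (s(r+1 := t))"
  obtain T where T: "T \<subseteq> B" "card T = t"
    and joined: "\<And>a b. a \<in> A \<Longrightarrow> b \<in> T \<Longrightarrow> {a, b} \<in> E1 \<inter> E2"
    using fully_joined_subset[OF AB fin card_B, of E1 E2] E1 E2
    unfolding near_complete_def by blast
  have "finite T" using T(1) fin(2) finite_subset by blast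
  then obtain h where h: "bij_betw h {..<t} T"
    using T(2) ex_bij_betw_nat_finite[of T] by (auto simp: atLeast0LessThan)
  define f where "f u = (if fst u = r + 1 then h (snd u) else g u)" for u
  have core: "u \<in> fst ?K \<and> f u = g u \<and> f u \<in> A" if "u \<in> fst ?H" "fst u \<noteq> r + 1" for u
  proof -
    have "u \<in> fst ?K"
      using that by (cases u) (auto simp: fst_complete_multipartite split: if_splits)
    then show ?thesis using that g by (auto simp: f_def bij_betw_def)
  qed
  have new: "snd u < t \<and> f u = h (snd u) \<and> f u \<in> T" if "u \<in> fst ?H" "fst u = r + 1" for u
  proof -
    have "snd u < t"
      using that by (cases u) (auto simp: fst_complete_multipartite)
    then show ?thesis using that h by (auto simp: f_def bij_betw_def)
  qed
  have apart: "a \<noteq> b" if "a \<in> A" "b \<in> T" for a b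
    using that T(1) AB by blast
  have "inj_on f (fst ?H)"
  proof (rule inj_onI)
    fix u v assume u: "u \<in> fst ?H" and v: "v \<in> fst ?H" and eq: "f u = f v"
    show "u = v"
    proof (cases "fst u = r + 1"; cases "fst v = r + 1")
      assume uv: "fst u = r + 1" "fst v = r + 1"
      then have "snd u = snd v"
        using new[OF u] new[OF v] eq h by (auto simp: bij_betw_def inj_on_def)
      then show ?thesis using uv by (simp add: prod_eq_iff)
    next
      assume "fst u \<noteq> r + 1" "fst v \<noteq> r + 1"
      then show ?thesis
        using core[OF u] core[OF v] eq g by (auto simp: bij_betw_def inj_on_def)
    next
      assume "fst u = r + 1" "fst v \<noteq> r + 1"
      then show ?thesis using new[OF u] core[OF v] eq apart by metis
    next
      assume "fst u \<noteq> r + 1" "fst v = r + 1"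
      then show ?thesis using core[OF u] new[OF v] eq apart by metis
    qed
  qed
  moreover have "f ` fst ?H \<subseteq> V"
    using core new T V by blast
  moreover have "f ` e \<in> E1 \<inter> E2" if "e \<in> snd ?H" for e
  proof -
    obtain u v where e: "e = {u, v}" and u: "u \<in> fst ?H" and v: "v \<in> fst ?H"
      and ne: "fst u \<noteq> fst v"
      using \<open>e \<in> snd ?H\<close> unfolding complete_multipartite_edge_iff by blast
    have img: "f ` e = {f u, f v}" by (simp add: e)
    consider "fst u = r + 1" "fst v \<noteq> r + 1" | "fst u \<noteq> r + 1" "fst v = r + 1"
      | "fst u \<noteq> r + 1" "fst v \<noteq> r + 1"
      using ne by linarith
    then show ?thesis
    proof cases
      case 1
      then show ?thesis
        using joined[of "f v" "f u"] new[OF u] core[OF v] img by (metis insert_commute)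
    next
      case 2
      then show ?thesis
        using joined[of "f u" "f v"] core[OF u] new[OF v] img by metis
    next
      case 3
      then have "e \<in> snd ?K"
        using core[OF u] core[OF v] ne e unfolding complete_multipartite_edge_iff by blast
      moreover have "f ` e = g ` e" using core[OF u] core[OF v] 3 by (simp add: e)
      ultimately have "f ` e \<in> C" by (simp add: C)
      then show ?thesis using E1 E2 unfolding near_complete_def by blast
    qed
  qed
  ultimately show ?thesis
    unfolding contains_copy_def by auto
qed

section \<open>The size of the family\<close>

text \<open>Here \<open>u\<close> counts all pairs, \<open>c\<close> the prescribed edges inside \<open>A\<close>, and \<open>S * (t + 2)\<close> the edges
  between \<open>A\<close> and \<open>B\<close>. A small \<open>c\<close> only makes the family larger, so an upper bound \<open>m\<close> on it is
  enough.\<close>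

lemma near_complete_count_gt:
  fixes S t u c m :: nat
  assumes S: "S \<ge> 1" and t: "int t > 2 ^ (2 * S) - 2 * int S - 1"
    and cm: "c \<le> m" and le: "c + S * (t + 2) \<le> u"
  shows "real ((S * (t + 2) + 1) * 2 ^ (u - c - S * (t + 2)))
           > 2 powr (real u - real m - real (S * t))"
proof -
  have "t \<le> S * t" using S by simp
  then have "int (S * (t + 2) + 1) \<ge> int t + 2 * int S + 1"
    by (simp add: algebra_simps flip: of_nat_mult)
  then have "int (2 ^ (2 * S)) < int (S * (t + 2) + 1)"
    using t by simp
  then have gain: "real (2 ^ (2 * S)) < real (S * (t + 2) + 1)"
    by linarith
  have "2 powr (real u - real m - real (S * t)) \<le> 2 powr (real u - real c - real (S * t))"
    using cm by simp
  also have "\<dots> = 2 powr (real (2 * S) + real (u - c - S * (t + 2)))"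
    using le by (simp add: of_nat_diff algebra_simps)
  also have "\<dots> = real (2 ^ (2 * S)) * 2 ^ (u - c - S * (t + 2))"
    by (simp add: powr_add powr_realpow del: of_nat_diff of_nat_mult)
  also have "\<dots> < real (S * (t + 2) + 1) * 2 ^ (u - c - S * (t + 2))"
    using gain by (intro mult_strict_right_mono) auto
  finally show ?thesis by (simp only: of_nat_mult of_nat_power of_nat_numeral)
qed

theorem theorem12:
  fixes r t :: nat and s :: "nat \<Rightarrow> nat"
  assumes "r \<ge> 1"
    and "\<And>i. i \<in> {1..r} \<Longrightarrow> s i \<ge> 1"
    and "int t > 2 ^ (2 * (\<Sum>i=1..r. s i)) - 2 * int (\<Sum>i=1..r. s i) - 1"
  shows "\<exists>N. \<forall>n\<ge>N. \<exists>F. intersecting_family n (complete_multipartite {1..r+1} (s(r+1 := t))) F \<and>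
           real (card F) >
             2 powr (real (n choose 2) - real (\<Sum>j=1..r. \<Sum>i=1..<j. s i * s j)
                     - real (\<Sum>i=1..r. s i * t))"
proof -
  define S where "S = (\<Sum>i=1..r. s i)"
  define m where "m = (\<Sum>j=1..r. \<Sum>i=1..<j. s i * s j)"
  define A where "A = {1..S}"
  define B where "B = {S+1..S+t+2}"
  let ?K = "complete_multipartite {1..r} s"
  let ?X = "biclique A B"
  have "S \<ge> s 1"
    unfolding S_def using \<open>r \<ge> 1\<close> by (intro member_le_sum) auto
  then have S: "S \<ge> 1" using assms(2)[of 1] \<open>r \<ge> 1\<close> by simp
  have AB: "A \<inter> B = {}" and fin: "finite A" "finite B"
    and cards: "card A = S" "card B = t + 2"
    by (auto simp: A_def B_def)
  have "finite (fst ?K)" "card (fst ?K) = card A"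
    by (auto simp: fst_complete_multipartite cards S_def)
  then obtain g where g: "bij_betw g (fst ?K) A"
    using finite_same_card_bij fin(1) by blast
  define C where "C = (\<lambda>e. g ` e) ` snd ?K"
  have edge_A: "e \<subseteq> A \<and> card e = 2" if "e \<in> C" for e
  proof -
    obtain d where "d \<in> snd ?K" "e = g ` d"
      using \<open>e \<in> C\<close> unfolding C_def by blast
    then obtain u v where "e = {g u, g v}" "u \<in> fst ?K" "v \<in> fst ?K" "u \<noteq> v"
      unfolding complete_multipartite_edge_iff by blast
    moreover from this have "g u \<noteq> g v"
      using g by (auto simp: bij_betw_def inj_on_def)
    ultimately show ?thesis using g by (auto simp: bij_betw_def)
  qed
  have CX: "C \<inter> ?X = {}"
  proof -
    have "\<not> {a, b} \<subseteq> A" if "b \<in> B" for a b using that AB by blast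
    then show ?thesis using edge_A by (auto simp: biclique_def)
  qed
  have "finite (snd ?K)"
  proof (rule finite_subset)
    show "snd ?K \<subseteq> Pow (fst ?K)" by (auto simp: complete_multipartite_edge_iff)
    show "finite (Pow (fst ?K))" using \<open>finite (fst ?K)\<close> by (rule finite_Pow_iff[THEN iffD2])
  qed
  then have "finite C" and "card C \<le> card (snd ?K)"
    unfolding C_def by (rule finite_imageI, rule card_image_le)
  then have cm: "card C \<le> m"
    using card_complete_multipartite_edges_le[of r s] unfolding m_def by linarith
  have card_X: "card ?X = S * (t + 2)"
    using card_biclique[OF AB] cards by simp
  have "\<exists>F. intersecting_family n (complete_multipartite {1..r+1} (s(r+1 := t))) F \<and>
          real (card F) > 2 powr (real (n choose 2) - real m - real (S * t))"
    if n: "n \<ge> S + t + 2" for n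
  proof -
    define F where "F = near_complete (all_pairs n) C ?X"
    have V: "A \<union> B \<subseteq> {1..n}" using n by (auto simp: A_def B_def)
    have finU: "finite (all_pairs n)"
      by (rule finite_subset[of _ "Pow {1..n}"]) (auto simp: all_pairs_def)
    have CU: "C \<subseteq> all_pairs n"
      using edge_A V unfolding all_pairs_def by blast
    have XU: "?X \<subseteq> all_pairs n"
    proof
      fix e assume "e \<in> ?X"
      then obtain a b where e: "e = {a, b}" and ab: "a \<in> A" "b \<in> B"
        by (auto simp: biclique_def)
      have "a \<noteq> b" using ab AB by blast
      then have "card e = 2" by (simp add: e)
      moreover have "e \<subseteq> {1..n}" unfolding e using ab V by blast
      ultimately show "e \<in> all_pairs n" by (simp add: all_pairs_def)
    qed
    have "card (C \<union> ?X) \<le> card (all_pairs n)"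
      using finU CU XU by (intro card_mono) auto
    then have "card C + S * (t + 2) \<le> n choose 2"
      using card_Un_disjoint[OF \<open>finite C\<close> _ CX] finite_subset[OF XU finU]
      by (simp add: card_X card_all_pairs)
    then have "2 powr (real (n choose 2) - real m - real (S * t)) < real (card F)"
      using near_complete_count_gt[OF S _ cm] assms(3)
      by (simp only: F_def card_near_complete[OF finU CU XU CX] card_X card_all_pairs S_def)
    moreover have "intersecting_family n (complete_multipartite {1..r+1} (s(r+1 := t))) F"
      unfolding intersecting_family_def
    proof (intro conjI ballI)
      show "F \<subseteq> Pow (all_pairs n)" by (auto simp: F_def near_complete_def)
      fix E1 E2 assume "E1 \<in> F" "E2 \<in> F"
      then show "contains_copy ({1..n}, E1 \<inter> E2) (complete_multipartite {1..r+1} (s(r+1 := t)))"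
        using contains_copy_near_complete[OF g C_def AB fin cards(2) V] by (simp add: F_def)
    qed
    ultimately show ?thesis by blast
  qed
  moreover have "(\<Sum>i=1..r. s i * t) = S * t"
    by (simp add: S_def sum_distrib_right)
  ultimately show ?thesis
    unfolding m_def by auto
qed

end
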